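(* Let $n,d,w$ be positive integers with $d\le w\le n/2$. Then $$ A(n,2d,w)\ \ge\ \frac{\binom{n}{w}}{V(n,d-1,w)}\cdot\frac{\log_2 V(n,d-1,w)-\log_2\sqrt{e(n,d-1,w)}}{10}, $$ where $V(n,r,w)$ and $e(n,r,w)$ are as defined in the context.
   Context: $A(n,2d,w)$ is the maximum number of codewords in a binary code of length $n$, all codewords of Hamming weight $w$, with minimum Hamming distance $2d$. $V(n,r,w)=\sum_{i=0}^{r}\binom{w}{i}\binom{n-w}{i}$. For positive integers $i,j,k\le w$ with $k\le i+j$, set $$ p^k_{i,j}=\sum_{l=a}^{b}\binom{n-w-k}{l}\binom{k}{i-l}\binom{k}{j-l}\binom{w-k}{i+j-k-l}, $$ where $a=\max\{0,i-k,j-k,i+j-w\}$ and $b=\min\{i,j,i+j-k,n-w-k\}$; set $p^k_{i,j}=0$ for $k>i+j$. Define $$ e(n,r,w)=\frac16\sum_{i=1}^{r}\sum_{j=1}^{r}\sum_{k=1}^{r}\binom{w}{k}\binom{n-w}{k}p^k_{i,j}. $$ *)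

theory Defs
  imports Complex_Main
begin

definition hamming_weight :: "bool list \<Rightarrow> nat" where
  "hamming_weight x = card {i. i < length x \<and> x ! i}"

definition hamming_dist :: "bool list \<Rightarrow> bool list \<Rightarrow> nat" where
  "hamming_dist x y = card {i. i < length x \<and> x ! i \<noteq> y ! i}"

text \<open>As usual in coding theory, ``minimum distance \<open>\<delta>\<close>'' bounds all distances between distinct
  codewords from below; codes with fewer than two codewords satisfy this vacuously.\<close>

definition constant_weight_codes :: "nat \<Rightarrow> nat \<Rightarrow> nat \<Rightarrow> bool list set set" where
  "constant_weight_codes n \<delta> w =
     {C. C \<subseteq> {x. length x = n \<and> hamming_weight x = w} \<and>
         (\<forall>x\<in>C. \<forall>y\<in>C. x \<noteq> y \<longrightarrow> \<delta> \<le> hamming_dist x y)}"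

definition A :: "nat \<Rightarrow> nat \<Rightarrow> nat \<Rightarrow> nat" where
  "A n \<delta> w = Max (card ` constant_weight_codes n \<delta> w)"

text \<open>The maximum above is taken over a finite, nonempty set.\<close>

lemma finite_constant_weight_codes: "finite (constant_weight_codes n \<delta> w)"
proof (rule finite_subset)
  show "constant_weight_codes n \<delta> w \<subseteq> Pow {x. set x \<subseteq> UNIV \<and> length x = n}"
    by (auto simp: constant_weight_codes_def)
  show "finite (Pow {x :: bool list. set x \<subseteq> UNIV \<and> length x = n})"
    by (simp only: finite_Pow_iff finite_lists_length_eq finite)
qed

lemma empty_in_constant_weight_codes: "{} \<in> constant_weight_codes n \<delta> w"
  by (simp add: constant_weight_codes_def)

definition V :: "nat \<Rightarrow> nat \<Rightarrow> nat \<Rightarrow> nat" where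
  "V n r w = (\<Sum>i=0..r. (w choose i) * ((n - w) choose i))"

text \<open>\<open>p n w i j k\<close> is the number \<open>p\<^sup>k\<^sub>i\<^sub>,\<^sub>j\<close> for weight-\<open>w\<close> words of length \<open>n\<close>. Truncated subtraction
  on \<^typ>\<open>nat\<close> agrees with integer subtraction here: in the lower limit of summation because of
  the maximum with 0, and elsewhere because \<open>k \<le> i + j\<close>, \<open>l \<le> min i (min j (i + j - k))\<close> and,
  when \<open>k \<le> w\<close> and \<open>2 * w \<le> n\<close>, also \<open>k \<le> n - w\<close>.\<close>

definition p :: "nat \<Rightarrow> nat \<Rightarrow> nat \<Rightarrow> nat \<Rightarrow> nat \<Rightarrow> nat" where
  "p n w i j k =
     (if k > i + j then 0
      else (\<Sum>l = Max {0, i - k, j - k, i + j - w} .. Min {i, j, i + j - k, n - w - k}.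
              ((n - w - k) choose l) * (k choose (i - l)) * (k choose (j - l)) *
              ((w - k) choose (i + j - k - l))))"

text \<open>For \<open>r = 0\<close> the sum below is empty, and \<open>log 2 (sqrt (e n 0 w))\<close> takes the conventional
  value \<open>log 2 0 = 0\<close>. If \<open>1 \<le> r < w\<close> and \<open>2 * w \<le> n\<close>, then \<open>e n r w\<close> is positive.\<close>

definition e :: "nat \<Rightarrow> nat \<Rightarrow> nat \<Rightarrow> real" where
  "e n r w = 1 / 6 *
     real (\<Sum>i=1..r. \<Sum>j=1..r. \<Sum>k=1..r. (w choose k) * ((n - w) choose k) * p n w i j k)"

end

theory Submission
  imports Defs
begin

text \<open>Codes are the independent sets of the graph on the \<open>w\<close>-subsets of \<open>{..<n}\<close> in which \<open>X\<close> and
  \<open>Y\<close> are adjacent when \<open>0 < card (X - Y) < d\<close>. All degrees are at most \<open>D = V - 1\<close>, and every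
  neighbourhood contains at most \<open>6 * e\<close> ordered adjacent pairs.

  Choose an independent set \<open>W\<close> with probability proportional to \<open>t ^ card W\<close> (the hard-core model
  of fugacity \<open>t\<close>) and condition on \<open>W\<close> outside the closed neighbourhood of a vertex \<open>v\<close>. Let \<open>X\<close> be the set of
  neighbours of \<open>v\<close> that remain available. If \<open>X\<close> is large then, since it induces few edges, many
  of its elements lie in \<open>W\<close> on average; if \<open>X\<close> is small then it has few independent sets, so \<open>v\<close>
  itself is likely to lie in \<open>W\<close>. In either case the mean of \<open>D * [v \<in> W] + card (N(v) \<inter> W)\<close> is at
  least some \<open>K\<close>. As the sum over \<open>v\<close> is at most \<open>2 * D * card W\<close>, some \<open>W\<close> satisfies
  \<open>card W \<ge> K / (2 * D)\<close> times the number of vertices. With \<open>M = V / sqrt e\<close> the choice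
  \<open>t = 1 / (5 * sqrt e)\<close> allows \<open>K = (D / V) * log 2 M / 5\<close> once \<open>M \<ge> 1024\<close>; for smaller \<open>M\<close> the
  logarithm is at most 10 and a maximal independent set is large enough.\<close>

subsection \<open>Independent sets in locally sparse graphs\<close>

definition indep :: "('a \<Rightarrow> 'a \<Rightarrow> bool) \<Rightarrow> 'a set \<Rightarrow> bool" where
  "indep adj S \<longleftrightarrow> (\<forall>x\<in>S. \<forall>y\<in>S. \<not> adj x y)"

definition indep_sets :: "('a \<Rightarrow> 'a \<Rightarrow> bool) \<Rightarrow> 'a set \<Rightarrow> 'a set set" where
  "indep_sets adj X = {S. S \<subseteq> X \<and> indep adj S}"

text \<open>The independence polynomial of the graph induced on \<open>X\<close>, also the partition
  function of the hard-core model: dividing \<open>t ^ card S\<close> by it gives the probability of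
  \<open>S\<close>.\<close>

definition indep_poly :: "('a \<Rightarrow> 'a \<Rightarrow> bool) \<Rightarrow> 'a set \<Rightarrow> real \<Rightarrow> real" where
  "indep_poly adj X t = (\<Sum>S\<in>indep_sets adj X. t ^ card S)"

lemma finite_indep_sets [simp]: "finite X \<Longrightarrow> finite (indep_sets adj X)"
  by (rule finite_subset[of _ "Pow X"]) (auto simp: indep_sets_def)

lemma finite_mem_indep_sets: "finite X \<Longrightarrow> S \<in> indep_sets adj X \<Longrightarrow> finite S"
  by (auto simp: indep_sets_def intro: finite_subset)

lemma indep_poly_ge_1:
  fixes t :: real and X :: "'a set"
  assumes "finite X" "0 \<le> t"
  shows "1 \<le> indep_poly adj X t"
proof -
  have "{} \<in> indep_sets adj X"
    by (simp add: indep_sets_def indep_def)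
  then have "t ^ card ({} :: 'a set) \<le> indep_poly adj X t"
    unfolding indep_poly_def
    by (rule member_le_sum[where f = "\<lambda>S. t ^ card S"]) (use assms in auto)
  then show ?thesis by simp
qed

section \<open>Deletion of vertices from the independence polynomial\<close>

text \<open>Taking \<open>u\<close> out of the independent sets that contain it is injective, leads
  into \<open>X - {u}\<close> and divides the weight by \<open>t\<close>.\<close>

lemma indep_poly_remove_vertex:
  assumes "finite X" "0 \<le> t" "u \<in> X"
  shows "indep_poly adj X t \<le> (1 + t) * indep_poly adj (X - {u}) t"
proof -
  let ?N = "indep_sets adj (X - {u})"
  let ?I = "{S \<in> indep_sets adj X. u \<in> S}"
  have eq: "indep_sets adj X = ?N \<union> ?I"
    by (auto simp: indep_sets_def)
  have fin: "finite ?I" "finite ?N"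
    using assms by auto
  have "(\<Sum>S\<in>?I. t ^ card S) = (\<Sum>S\<in>(\<lambda>S. S - {u}) ` ?I. t * t ^ card S)"
  proof (subst sum.reindex)
    show "inj_on (\<lambda>S. S - {u}) ?I"
      by (auto simp: inj_on_def)
    show "(\<Sum>S\<in>?I. t ^ card S) = sum ((\<lambda>S. t * t ^ card S) \<circ> (\<lambda>S. S - {u})) ?I"
    proof (rule sum.cong)
      fix S assume "S \<in> ?I"
      then have "finite S" "u \<in> S"
        using assms(1) finite_mem_indep_sets by auto
      then have "card S = Suc (card (S - {u}))"
        by (simp only: card_Suc_Diff1)
      then show "t ^ card S = ((\<lambda>S. t * t ^ card S) \<circ> (\<lambda>S. S - {u})) S"
        by simp
    qed simp
  qed
  also have "\<dots> \<le> (\<Sum>S\<in>?N. t * t ^ card S)"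
    by (rule sum_mono2) (use fin assms in \<open>auto simp: indep_sets_def indep_def\<close>)
  also have "\<dots> = t * indep_poly adj (X - {u}) t"
    by (simp add: indep_poly_def sum_distrib_left)
  finally have 1: "(\<Sum>S\<in>?I. t ^ card S) \<le> t * indep_poly adj (X - {u}) t" .
  have "indep_poly adj X t = (\<Sum>S\<in>?N. t ^ card S) + (\<Sum>S\<in>?I. t ^ card S)"
    unfolding indep_poly_def
    by (subst eq, rule sum.union_disjoint) (use fin in \<open>auto simp: indep_sets_def\<close>)
  with 1 show ?thesis
    by (simp add: indep_poly_def algebra_simps)
qed

lemma indep_poly_remove:
  assumes "finite X" "0 \<le> t" "B \<subseteq> X"
  shows "indep_poly adj X t \<le> (1 + t) ^ card B * indep_poly adj (X - B) t"
proof -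
  have "finite B"
    using assms finite_subset by auto
  then show ?thesis
    using assms(3)
  proof (induction B)
    case empty
    then show ?case by simp
  next
    case (insert u B)
    have "indep_poly adj X t \<le> (1 + t) ^ card B * indep_poly adj (X - B) t"
      using insert by auto
    also have "\<dots> \<le> (1 + t) ^ card B * ((1 + t) * indep_poly adj (X - B - {u}) t)"
      using insert assms by (intro mult_left_mono indep_poly_remove_vertex) auto
    also have "\<dots> = (1 + t) ^ card (insert u B) * indep_poly adj (X - insert u B) t"
      using insert by (simp add: Diff_insert[of X u B])
    finally show ?case .
  qed
qed

lemma indep_poly_le_exp:
  assumes "finite X" "0 \<le> t"
  shows "indep_poly adj X t \<le> exp (t * card X)"
proof -
  have "indep_poly adj X t \<le> (1 + t) ^ card X * indep_poly adj (X - X) t"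
    by (rule indep_poly_remove) (use assms in auto)
  also have "indep_poly adj (X - X) t = 1"
  proof -
    have "indep_sets adj {} = {{}}"
      by (auto simp: indep_sets_def indep_def)
    then show ?thesis
      by (simp add: indep_poly_def)
  qed
  also have "(1 + t) ^ card X \<le> exp t ^ card X"
    using assms by (intro power_mono) auto
  also have "exp t ^ card X = exp (t * card X)"
    by (simp add: exp_of_nat_mult[symmetric] mult.commute)
  finally show ?thesis by simp
qed

locale fin_graph =
  fixes vs :: "'a set" and adj :: "'a \<Rightarrow> 'a \<Rightarrow> bool"
  assumes finite_vs: "finite vs"
    and adj_sym: "adj x y \<Longrightarrow> adj y x"
    and adj_irrefl: "\<not> adj x x"
begin

definition nbh :: "'a \<Rightarrow> 'a set" where
  "nbh v = {u \<in> vs. adj v u}"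

lemma nbh_subset: "nbh v \<subseteq> vs"
  by (auto simp: nbh_def)

lemma finite_nbh [simp]: "finite (nbh v)"
  using nbh_subset finite_vs finite_subset by blast

lemma not_in_nbh [simp]: "v \<notin> nbh v"
  using adj_irrefl by (auto simp: nbh_def)

section \<open>Occupation of vertices in the hard-core model\<close>

text \<open>Sets containing \<open>u\<close> arise by adding \<open>u\<close> to independent sets
  that avoid its closed neighbourhood, and deleting that neighbourhood costs at most a power of
  \<open>1 + t\<close>. The bound is linear in the degree so that its sum over \<open>u\<close>
  involves only the number of edges.\<close>

lemma sum_indep_vertex_ge:
  fixes t :: real
  assumes X: "finite X" "0 \<le> t" "u \<in> X"
  shows "(\<Sum>S\<in>{S \<in> indep_sets adj X. u \<in> S}. t ^ card S)
     \<ge> t * (1 - t * (card {y\<in>X. adj u y} + 1)) * indep_poly adj X t"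
proof -
  let ?B = "insert u {y\<in>X. adj u y}"
  let ?d = "card {y\<in>X. adj u y}"
  let ?P = "indep_poly adj (X - ?B) t"
  have cB: "card ?B = ?d + 1"
    using X adj_irrefl by auto
  have P1: "1 \<le> ?P"
    using X by (intro indep_poly_ge_1) auto
  have "indep_poly adj X t \<le> (1 + t) ^ (?d + 1) * ?P"
    using indep_poly_remove[of X t ?B adj] X cB by auto
  moreover have "1 - t * (?d + 1) \<le> 1 / (1 + t) ^ (?d + 1)"
  proof -
    \<comment> \<open>From \<open>1 - x \<le> exp (- x)\<close> and \<open>1 + t \<le> exp t\<close>
      if the first factor is nonnegative; otherwise the product is at most 0.\<close>
    have "(1 - t * (?d + 1)) * (1 + t) ^ (?d + 1) \<le> 1"
    proof (cases "1 - t * (?d + 1) \<ge> 0")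
      case True
      have "(1 - t * (?d + 1)) * (1 + t) ^ (?d + 1) \<le> exp (- (t * (?d + 1))) * exp t ^ (?d + 1)"
      proof (intro mult_mono power_mono)
        show "1 - t * (?d + 1) \<le> exp (- (t * (?d + 1)))"
          using exp_ge_add_one_self[of "- (t * (?d + 1))"] by linarith
      qed (use X in auto)
      also have "exp t ^ (?d + 1) = exp (t * (?d + 1))"
        by (simp only: exp_of_nat_mult[symmetric] mult.commute)
      also have "exp (- (t * (?d + 1))) * exp (t * (?d + 1)) = 1"
        by (simp only: mult_exp_exp) simp
      finally show ?thesis .
    next
      case False
      then have "(1 - t * (?d + 1)) * (1 + t) ^ (?d + 1) \<le> 0"
        using X by (intro mult_nonpos_nonneg) auto
      then show ?thesis by simp
    qed
    then show ?thesis
      using X by (subst pos_le_divide_eq) auto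
  qed
  ultimately have "(1 - t * (?d + 1)) * indep_poly adj X t \<le> ?P"
  proof -
    assume a: "indep_poly adj X t \<le> (1 + t) ^ (?d + 1) * ?P"
      and b: "1 - t * (?d + 1) \<le> 1 / (1 + t) ^ (?d + 1)"
    have Z: "0 \<le> indep_poly adj X t"
      using indep_poly_ge_1[of X t adj] X by linarith
    have "(1 - t * (?d + 1)) * indep_poly adj X t \<le> 1 / (1 + t) ^ (?d + 1) * indep_poly adj X t"
      by (rule mult_right_mono[OF b Z])
    also have "\<dots> \<le> 1 / (1 + t) ^ (?d + 1) * ((1 + t) ^ (?d + 1) * ?P)"
      using X by (intro mult_left_mono[OF a]) auto
    also have "\<dots> = ?P"
      using X by simp
    finally show ?thesis .
  qed
  then have "t * ((1 - t * (?d + 1)) * indep_poly adj X t) \<le> t * ?P"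
    using X by (intro mult_left_mono) auto
  also have "t * ?P = (\<Sum>S\<in>indep_sets adj (X - ?B). t ^ card (insert u S))"
    unfolding indep_poly_def sum_distrib_left
  proof (rule sum.cong)
    fix S assume "S \<in> indep_sets adj (X - ?B)"
    then have "finite S" "u \<notin> S"
      using X finite_mem_indep_sets[of "X - ?B" S adj] by (auto simp: indep_sets_def)
    then show "t * t ^ card S = t ^ card (insert u S)"
      by simp
  qed simp
  also have "\<dots> = (\<Sum>S\<in>insert u ` indep_sets adj (X - ?B). t ^ card S)"
    by (subst sum.reindex) (auto simp: inj_on_def indep_sets_def)
  also have "\<dots> \<le> (\<Sum>S\<in>{S \<in> indep_sets adj X. u \<in> S}. t ^ card S)"
    by (rule sum_mono2)
      (use X adj_irrefl adj_sym in \<open>auto simp: indep_sets_def indep_def\<close>)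
  finally show ?thesis
    by (simp add: mult.assoc)
qed

text \<open>The size of a set is a sum of vertex indicators, so the bounds for single vertices add
  up; the degrees in \<open>X\<close> sum to the number of ordered adjacent pairs.\<close>

lemma sum_card_indep_ge:
  fixes t :: real
  assumes X: "finite X" "0 \<le> t"
  shows "(\<Sum>S\<in>indep_sets adj X. card S * t ^ card S)
     \<ge> (t * (1 - t) * card X - t\<^sup>2 * card {(y, z). y \<in> X \<and> z \<in> X \<and> adj y z}) * indep_poly adj X t"
proof -
  let ?d = "\<lambda>u. card {y\<in>X. adj u y}"
  have "{(y, z). y \<in> X \<and> z \<in> X \<and> adj y z} = (SIGMA u:X. {y\<in>X. adj u y})"
    by auto
  then have m: "card {(y, z). y \<in> X \<and> z \<in> X \<and> adj y z} = (\<Sum>u\<in>X. ?d u)"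
    using X by simp
  have "(t * (1 - t) * card X - t\<^sup>2 * card {(y, z). y \<in> X \<and> z \<in> X \<and> adj y z}) * indep_poly adj X t
     = (\<Sum>u\<in>X. t * (1 - t * (?d u + 1)) * indep_poly adj X t)"
    unfolding m by (simp add: sum_distrib_left sum_distrib_right sum.distrib sum_subtractf
      algebra_simps power2_eq_square)
  also have "\<dots> \<le> (\<Sum>u\<in>X. \<Sum>S\<in>{S \<in> indep_sets adj X. u \<in> S}. t ^ card S)"
    by (rule sum_mono, rule sum_indep_vertex_ge) (use X in auto)
  also have "\<dots> = (\<Sum>S\<in>indep_sets adj X. \<Sum>u\<in>{u\<in>X. u \<in> S}. t ^ card S)"
    by (rule sum.swap_restrict) (use X in auto)
  also have "\<dots> = (\<Sum>S\<in>indep_sets adj X. card S * t ^ card S)"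
  proof (rule sum.cong)
    fix S assume "S \<in> indep_sets adj X"
    then have "{u\<in>X. u \<in> S} = S"
      by (auto simp: indep_sets_def)
    then show "(\<Sum>u\<in>{u\<in>X. u \<in> S}. t ^ card S) = card S * t ^ card S"
      by simp
  qed simp
  finally show ?thesis .
qed

section \<open>Scores around a single vertex\<close>

lemma indep_sets_star:
  assumes "X \<subseteq> nbh v"
  shows "indep_sets adj (insert v X) = insert {v} (indep_sets adj X)"
proof -
  have "S = {v}" if "S \<subseteq> insert v X" "indep adj S" "v \<in> S" for S
    using that assms by (auto simp: indep_def nbh_def)
  then show ?thesis
    using adj_irrefl by (auto simp: indep_sets_def) (auto simp: indep_def)
qed

text \<open>\<open>D\<close> will bound the degrees: an element of \<open>W\<close> then earns
  \<open>D\<close> at itself and at most \<open>D\<close> through its neighbours, so the two terms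
  are balanced.\<close>

definition score :: "real \<Rightarrow> 'a \<Rightarrow> 'a set \<Rightarrow> real" where
  "score D v W = (if v \<in> W then D else 0) + card (nbh v \<inter> W)"

text \<open>\<open>X\<close> consists of the neighbours of \<open>v\<close> left available. If the
  lower bound on the mean size of an independent subset of \<open>X\<close> reaches
  \<open>K\<close>, these subsets suffice, since \<open>{v}\<close> scores \<open>D \<ge> K\<close>.
  Otherwise \<open>card X\<close> is small, the polynomial of \<open>X\<close> is at most the
  exponential in \<open>bal\<close>, and the surplus \<open>(D - K) * t\<close> of
  \<open>{v}\<close> pays for all the other sets.\<close>

lemma local_score_ge:
  fixes t K D q :: real
  assumes X: "X \<subseteq> nbh v" and t: "0 < t" "t < 1" and K: "0 \<le> K" "K \<le> D"
    and tri: "card {(y, z). y \<in> nbh v \<and> z \<in> nbh v \<and> adj y z} \<le> q"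
    and bal: "K * exp ((K + t\<^sup>2 * q) / (1 - t)) \<le> (D - K) * t"
  shows "K * indep_poly adj (insert v X) t
    \<le> (\<Sum>T\<in>indep_sets adj (insert v X). t ^ card T * score D v T)"
proof -
  let ?Z = "indep_poly adj X t"
  have fX: "finite X"
    using X finite_subset by fastforce
  have v: "{v} \<notin> indep_sets adj X" "v \<notin> X"
    using X by (auto simp: indep_sets_def)
  have Z: "indep_poly adj (insert v X) t = t + ?Z"
    unfolding indep_poly_def indep_sets_star[OF X] using fX v by simp
  have "(\<Sum>T\<in>indep_sets adj (insert v X). t ^ card T * score D v T)
      = t * D + (\<Sum>T\<in>indep_sets adj X. t ^ card T * score D v T)"
    unfolding indep_sets_star[OF X] using fX v by (simp add: score_def)
  also have "(\<Sum>T\<in>indep_sets adj X. t ^ card T * score D v T)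
      = (\<Sum>T\<in>indep_sets adj X. card T * t ^ card T)"
  proof (rule sum.cong)
    fix T assume "T \<in> indep_sets adj X"
    then have "T \<subseteq> X" by (simp add: indep_sets_def)
    then have "nbh v \<inter> T = T" "v \<notin> T"
      using X v by auto
    then show "t ^ card T * score D v T = card T * t ^ card T"
      by (simp add: score_def)
  qed simp
  finally have S: "(\<Sum>T\<in>indep_sets adj (insert v X). t ^ card T * score D v T)
      = t * D + (\<Sum>T\<in>indep_sets adj X. card T * t ^ card T)" .
  let ?m = "t * (1 - t) * card X - t\<^sup>2 * card {(y, z). y \<in> X \<and> z \<in> X \<and> adj y z}"
  have Z1: "1 \<le> ?Z"
    using fX t by (intro indep_poly_ge_1) auto
  show ?thesis
  proof (cases "K \<le> ?m")
    case True
    have "K * ?Z \<le> ?m * ?Z"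
      using True Z1 by (intro mult_right_mono) auto
    also have "\<dots> \<le> (\<Sum>T\<in>indep_sets adj X. card T * t ^ card T)"
      using sum_card_indep_ge[OF fX, of t] t by simp
    finally have "K * ?Z \<le> (\<Sum>T\<in>indep_sets adj X. card T * t ^ card T)" .
    moreover have "K * t \<le> t * D"
      using t K by simp
    ultimately show ?thesis
      unfolding Z S by (simp add: algebra_simps)
  next
    case False
    have "card {(y, z). y \<in> X \<and> z \<in> X \<and> adj y z}
        \<le> card {(y, z). y \<in> nbh v \<and> z \<in> nbh v \<and> adj y z}"
      by (rule card_mono) (use X in \<open>auto intro: finite_subset[of _ "nbh v \<times> nbh v"]\<close>)
    then have "real (card {(y, z). y \<in> X \<and> z \<in> X \<and> adj y z}) \<le> q"
      using tri by linarith
    then have "t\<^sup>2 * card {(y, z). y \<in> X \<and> z \<in> X \<and> adj y z} \<le> t\<^sup>2 * q"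
      by (intro mult_left_mono) auto
    then have "t * card X * (1 - t) \<le> K + t\<^sup>2 * q"
      using False by (simp add: algebra_simps)
    then have "t * card X \<le> (K + t\<^sup>2 * q) / (1 - t)"
      using t by (subst pos_le_divide_eq) auto
    then have "?Z \<le> exp ((K + t\<^sup>2 * q) / (1 - t))"
      using indep_poly_le_exp[OF fX, of t adj] t
      by (meson exp_le_cancel_iff less_eq_real_def order_trans)
    then have "K * ?Z \<le> (D - K) * t"
      using bal K by (meson mult_left_mono order_trans)
    moreover have "0 \<le> (\<Sum>T\<in>indep_sets adj X. card T * t ^ card T)"
      using t by (intro sum_nonneg) auto
    ultimately show ?thesis
      unfolding Z S by (simp add: algebra_simps)
  qed
qed

text \<open>An independent set splits into its part outside the closed neighbourhood of \<open>v\<close> and an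
  independent subset of the star formed by \<open>v\<close> and the neighbours left available.\<close>

lemma sum_indep_sets_split:
  fixes t :: real and g :: "'a set \<Rightarrow> real"
  assumes v: "v \<in> vs"
    and g: "\<And>U T. U \<inter> insert v (nbh v) = {} \<Longrightarrow> g (U \<union> T) = g T"
  shows "(\<Sum>W\<in>indep_sets adj vs. t ^ card W * g W)
    = (\<Sum>U\<in>indep_sets adj (vs - insert v (nbh v)). t ^ card U *
         (\<Sum>T\<in>indep_sets adj (insert v {u\<in>nbh v. \<forall>x\<in>U. \<not> adj u x}). t ^ card T * g T))"
proof -
  let ?B = "insert v (nbh v)"
  let ?X = "\<lambda>U. insert v {u\<in>nbh v. \<forall>x\<in>U. \<not> adj u x}"
  let ?I = "indep_sets adj (vs - ?B)"
  have sub: "?X U \<subseteq> ?B" for U by auto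
  have Bvs: "?B \<subseteq> vs" using v nbh_subset by auto
  have vU: "\<not> adj v x" if "x \<in> vs - ?B" for x
    using that by (auto simp: nbh_def)
  have fI: "finite ?I" using finite_vs by simp
  have fX: "\<forall>U\<in>?I. finite (indep_sets adj (?X U))" by simp
  have "(\<Sum>W\<in>indep_sets adj vs. t ^ card W * g W)
     = (\<Sum>(U, T)\<in>(SIGMA U:?I. indep_sets adj (?X U)). t ^ card U * (t ^ card T * g T))"
  proof (rule sum.reindex_bij_witness[where i = "\<lambda>(U, T). U \<union> T" and j = "\<lambda>W. (W - ?B, W \<inter> ?B)"])
    fix W assume W: "W \<in> indep_sets adj vs"
    then have fW: "finite W" using finite_vs finite_mem_indep_sets by auto
    show "(\<lambda>(U, T). U \<union> T) (W - ?B, W \<inter> ?B) = W" by auto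
    show "(W - ?B, W \<inter> ?B) \<in> (SIGMA U:?I. indep_sets adj (?X U))"
      using W by (auto simp: indep_sets_def indep_def)
    have "card W = card (W - ?B) + card (W \<inter> ?B)"
      using card_Int_Diff[OF fW, of ?B] by simp
    moreover have "g W = g (W \<inter> ?B)"
      using g[of "W - ?B" "W \<inter> ?B"] by (metis Diff_disjoint Int_commute Un_Diff_Int)
    ultimately show "(case (W - ?B, W \<inter> ?B) of (U, T) \<Rightarrow> t ^ card U * (t ^ card T * g T))
        = t ^ card W * g W"
      by (simp add: power_add)
  next
    fix UT assume "UT \<in> (SIGMA U:?I. indep_sets adj (?X U))"
    then obtain U T where UT: "UT = (U, T)" "U \<in> ?I" "T \<in> indep_sets adj (?X U)" by auto
    have U: "U \<subseteq> vs - ?B" "indep adj U" and T: "T \<subseteq> ?X U" "indep adj T"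
      using UT by (auto simp: indep_sets_def)
    show "(\<lambda>W. (W - ?B, W \<inter> ?B)) ((\<lambda>(U, T). U \<union> T) UT) = UT"
      unfolding UT(1) using U(1) T(1) by auto
    \<comment> \<open>\<open>U\<close> contains no neighbour of \<open>v\<close>, and the other
      elements of \<open>T\<close> were selected to have no neighbour in \<open>U\<close>.\<close>
    have "\<not> adj a b" if "a \<in> T" "b \<in> U" for a b
      using that U(1) T(1) vU by auto
    then have "\<not> adj a b \<and> \<not> adj b a" if "a \<in> T" "b \<in> U" for a b
      using that adj_sym by blast
    then have "indep adj (U \<union> T)"
      using U(2) T(2) unfolding indep_def by blast
    then show "(\<lambda>(U, T). U \<union> T) UT \<in> indep_sets adj vs"
      unfolding UT(1) using U(1) T(1) Bvs by (auto simp: indep_sets_def)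
  qed
  also have "\<dots> = (\<Sum>U\<in>?I. \<Sum>T\<in>indep_sets adj (?X U). t ^ card U * (t ^ card T * g T))"
    by (rule sum.Sigma[symmetric]) (use fI fX in auto)
  finally show ?thesis
    by (simp add: sum_distrib_left)
qed

text \<open>For each fixed part \<open>U\<close> outside the closed neighbourhood, the local bound
  applies to the star that remains. The constant \<open>K\<close> is split in the same way, so the
  sums compare term by term.\<close>

lemma sum_score_ge:
  fixes t K D q :: real
  assumes v: "v \<in> vs" and t: "0 < t" "t < 1" and K: "0 \<le> K" "K \<le> D"
    and tri: "card {(y, z). y \<in> nbh v \<and> z \<in> nbh v \<and> adj y z} \<le> q"
    and bal: "K * exp ((K + t\<^sup>2 * q) / (1 - t)) \<le> (D - K) * t"
  shows "K * indep_poly adj vs t \<le> (\<Sum>W\<in>indep_sets adj vs. t ^ card W * score D v W)"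
proof -
  let ?B = "insert v (nbh v)"
  let ?X = "\<lambda>U. {u\<in>nbh v. \<forall>x\<in>U. \<not> adj u x}"
  let ?I = "indep_sets adj (vs - ?B)"
  have "K * indep_poly adj vs t = (\<Sum>W\<in>indep_sets adj vs. t ^ card W * K)"
    by (simp add: indep_poly_def sum_distrib_left mult.commute)
  also have "\<dots> = (\<Sum>U\<in>?I. t ^ card U * (\<Sum>T\<in>indep_sets adj (insert v (?X U)). t ^ card T * K))"
    by (rule sum_indep_sets_split[OF v]) simp
  also have "\<dots> \<le> (\<Sum>U\<in>?I. t ^ card U *
      (\<Sum>T\<in>indep_sets adj (insert v (?X U)). t ^ card T * score D v T))"
  proof (rule sum_mono, rule mult_left_mono)
    fix U
    have "K * indep_poly adj (insert v (?X U)) t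
      \<le> (\<Sum>T\<in>indep_sets adj (insert v (?X U)). t ^ card T * score D v T)"
      by (rule local_score_ge[OF _ t K tri bal]) auto
    then show "(\<Sum>T\<in>indep_sets adj (insert v (?X U)). t ^ card T * K)
      \<le> (\<Sum>T\<in>indep_sets adj (insert v (?X U)). t ^ card T * score D v T)"
      by (simp add: indep_poly_def sum_distrib_left mult.commute)
  qed (use t in simp)
  also have "\<dots> = (\<Sum>W\<in>indep_sets adj vs. t ^ card W * score D v W)"
  proof (rule sum_indep_sets_split[OF v, symmetric])
    fix U T assume U: "U \<inter> insert v (nbh v) = {}"
    then have "nbh v \<inter> (U \<union> T) = nbh v \<inter> T" by auto
    with U show "score D v (U \<union> T) = score D v T"
      by (auto simp: score_def)
  qed
  finally show ?thesis .
qed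

section \<open>Averaging the scores over all vertices\<close>

lemma sum_score_le:
  fixes D :: real
  assumes W: "W \<subseteq> vs" and deg: "\<And>u. u \<in> vs \<Longrightarrow> card (nbh u) \<le> D"
  shows "(\<Sum>v\<in>vs. score D v W) \<le> 2 * D * card W"
proof -
  have fW: "finite W" using W finite_vs finite_subset by auto
  have "(\<Sum>v\<in>vs. real (card (nbh v \<inter> W))) = (\<Sum>v\<in>vs. \<Sum>u\<in>{u\<in>W. adj v u}. 1)"
  proof (rule sum.cong)
    fix v
    have "nbh v \<inter> W = {u\<in>W. adj v u}" using W by (auto simp: nbh_def)
    then show "real (card (nbh v \<inter> W)) = (\<Sum>u\<in>{u\<in>W. adj v u}. 1)" by simp
  qed simp
  also have "\<dots> = (\<Sum>u\<in>W. \<Sum>v\<in>{v\<in>vs. adj v u}. 1)"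
    by (rule sum.swap_restrict[OF finite_vs fW])
  also have "\<dots> \<le> (\<Sum>u\<in>W. D)"
  proof (rule sum_mono)
    fix u assume "u \<in> W"
    moreover have "{v\<in>vs. adj v u} = nbh u" using adj_sym by (auto simp: nbh_def)
    ultimately show "(\<Sum>v\<in>{v\<in>vs. adj v u}. 1) \<le> D" using deg W by auto
  qed
  finally have 1: "(\<Sum>v\<in>vs. real (card (nbh v \<inter> W))) \<le> D * card W"
    by (simp add: mult.commute)
  have "(\<Sum>v\<in>vs. if v \<in> W then D else 0) = (\<Sum>v\<in>vs \<inter> W. D)"
    using finite_vs by (simp add: sum.If_cases)
  also have "vs \<inter> W = W" using W by auto
  finally show ?thesis
    using 1 unfolding score_def sum.distrib by (simp add: mult.commute)
qed

text \<open>First-moment argument: each vertex has mean score at least \<open>K\<close>, and each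
  \<open>W\<close> has total score at most \<open>2 * D * card W\<close>. If every \<open>W\<close>
  fell short, summing with the positive weights \<open>t ^ card W\<close> would give a
  contradiction.\<close>

lemma indep_set_locally_sparse:
  fixes t K D q :: real
  assumes t: "0 < t" "t < 1" and K: "0 \<le> K" "K \<le> D"
    and deg: "\<And>u. u \<in> vs \<Longrightarrow> card (nbh u) \<le> D"
    and tri: "\<And>v. v \<in> vs \<Longrightarrow> card {(y, z). y \<in> nbh v \<and> z \<in> nbh v \<and> adj y z} \<le> q"
    and bal: "K * exp ((K + t\<^sup>2 * q) / (1 - t)) \<le> (D - K) * t"
  obtains W where "W \<in> indep_sets adj vs" "K * card vs \<le> 2 * D * card W"
proof -
  let ?I = "indep_sets adj vs"
  have Zpos: "0 < indep_poly adj vs t"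
    using indep_poly_ge_1[OF finite_vs, of t adj] t by linarith
  have fI: "finite ?I" using finite_vs by simp
  have "\<exists>W\<in>?I. K * card vs \<le> 2 * D * card W"
  proof (rule ccontr)
    assume "\<not> ?thesis"
    then have less: "2 * D * card W < K * card vs" if "W \<in> ?I" for W
      using that by force
    have "K * card vs * indep_poly adj vs t = (\<Sum>v\<in>vs. K * indep_poly adj vs t)"
      by simp
    also have "\<dots> \<le> (\<Sum>v\<in>vs. \<Sum>W\<in>?I. t ^ card W * score D v W)"
      by (rule sum_mono, rule sum_score_ge[OF _ t K tri bal])
    also have "\<dots> = (\<Sum>W\<in>?I. t ^ card W * (\<Sum>v\<in>vs. score D v W))"
      by (subst sum.swap) (simp add: sum_distrib_left)
    also have "\<dots> \<le> (\<Sum>W\<in>?I. t ^ card W * (2 * D * card W))"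
      by (intro sum_mono mult_left_mono sum_score_le deg) (use t in \<open>auto simp: indep_sets_def\<close>)
    also have "\<dots> < (\<Sum>W\<in>?I. t ^ card W * (K * card vs))"
    proof (rule sum_strict_mono[OF fI])
      show "?I \<noteq> {}" by (auto simp: indep_sets_def indep_def)
    qed (use less t in \<open>simp add: mult_less_cancel_left_pos\<close>)
    also have "\<dots> = K * card vs * indep_poly adj vs t"
      by (simp add: indep_poly_def sum_distrib_left mult.commute)
    finally show False by simp
  qed
  then show thesis using that by blast
qed

text \<open>A vertex outside the closed neighbourhoods of an independent set of maximum size could
  be added to it. So these neighbourhoods, of size at most \<open>D + 1\<close> each, cover
  \<open>vs\<close>.\<close>

lemma indep_set_greedy:
  assumes deg: "\<And>u. u \<in> vs \<Longrightarrow> card (nbh u) \<le> D"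
  obtains W where "W \<in> indep_sets adj vs" "card vs \<le> (D + 1) * card W"
proof -
  have ne: "{} \<in> indep_sets adj vs" by (simp add: indep_sets_def indep_def)
  have fin: "finite (card ` indep_sets adj vs)" "card ` indep_sets adj vs \<noteq> {}"
    using ne finite_vs by auto
  from Max_in[OF this] obtain W where W: "W \<in> indep_sets adj vs"
    and "card W = Max (card ` indep_sets adj vs)" by force
  with fin(1) have max: "\<forall>S\<in>indep_sets adj vs. card S \<le> card W" by simp
  have fW: "finite W" using W finite_vs finite_mem_indep_sets by auto
  have "vs \<subseteq> (\<Union>u\<in>W. insert u (nbh u))"
  proof
    fix x assume x: "x \<in> vs"
    show "x \<in> (\<Union>u\<in>W. insert u (nbh u))"
    proof (rule ccontr)
      assume n: "x \<notin> (\<Union>u\<in>W. insert u (nbh u))"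
      then have "x \<notin> W" "\<forall>u\<in>W. \<not> adj u x" using x by (auto simp: nbh_def)
      then have "insert x W \<in> indep_sets adj vs"
        using W x adj_sym adj_irrefl by (auto simp: indep_sets_def indep_def)
      then have "card (insert x W) \<le> card W" using max by blast
      with \<open>x \<notin> W\<close> fW show False by simp
    qed
  qed
  then have "card vs \<le> card (\<Union>u\<in>W. insert u (nbh u))"
    using fW by (intro card_mono) auto
  also have "\<dots> \<le> (\<Sum>u\<in>W. card (insert u (nbh u)))"
    by (rule card_UN_le[OF fW])
  also have "\<dots> \<le> (\<Sum>u\<in>W. D + 1)"
    by (rule sum_mono) (use W deg in \<open>auto simp: indep_sets_def\<close>)
  also have "\<dots> = (D + 1) * card W" by simp
  finally show thesis using that W by blast
qed

end

subsection \<open>The graph of close constant-weight words\<close>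

text \<open>Words are represented by their supports; the Hamming distance of two words of weight
  \<open>w\<close> becomes \<open>2 * card (X - Y)\<close>.\<close>

definition wsets :: "nat \<Rightarrow> nat \<Rightarrow> nat set set" where
  "wsets n w = {X. X \<subseteq> {..<n} \<and> card X = w}"

text \<open>Bounding both differences makes the relation symmetric on arbitrary sets, as
  \<open>fin_graph\<close> demands; on \<open>wsets n w\<close> they have equal size.\<close>

definition near :: "nat \<Rightarrow> 'a set \<Rightarrow> 'a set \<Rightarrow> bool" where
  "near d X Y \<longleftrightarrow> X \<noteq> Y \<and> card (X - Y) < d \<and> card (Y - X) < d"

lemma finite_wsets [simp]: "finite (wsets n w)"
  by (rule finite_subset[of _ "Pow {..<n}"]) (auto simp: wsets_def)

lemma card_wsets: "card (wsets n w) = n choose w"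
  using n_subsets[of "{..<n}" w] by (simp add: wsets_def)

lemma finite_mem_wsets: "X \<in> wsets n w \<Longrightarrow> finite X"
  using finite_subset[of X "{..<n}"] by (simp add: wsets_def)

section \<open>Spheres of constant-weight words\<close>

lemma card_Diff_wsets:
  assumes "X \<in> wsets n w" "Y \<in> wsets n w"
  shows "card (Y - X) = card (X - Y)"
proof -
  have "finite X" "finite Y" "card X = card Y"
    using assms[THEN finite_mem_wsets] assms by (simp_all add: wsets_def)
  then show ?thesis
    using card_le_sym_Diff[of X Y] card_le_sym_Diff[of Y X] by simp
qed

text \<open>\<open>Y\<close> is determined by the \<open>k\<close> points it drops from
  \<open>X\<close> and the \<open>k\<close> points it gains outside \<open>X\<close>.\<close>

lemma card_sphere_le:
  assumes X: "X \<in> wsets n w"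
  shows "card {Y \<in> wsets n w. card (X - Y) = k} \<le> (w choose k) * ((n - w) choose k)"
proof -
  have fX: "finite X" "card X = w" "X \<subseteq> {..<n}"
    using finite_mem_wsets[OF X] X by (auto simp: wsets_def)
  let ?S = "{B. B \<subseteq> X \<and> card B = k}" and ?T = "{B. B \<subseteq> {..<n} - X \<and> card B = k}"
  have "card ({..<n} - X) = n - w"
    using fX by (simp add: card_Diff_subset)
  then have c: "card (?S \<times> ?T) = (w choose k) * ((n - w) choose k)"
    using fX by (simp add: card_cartesian_product n_subsets)
  have "card {Y \<in> wsets n w. card (X - Y) = k} \<le> card (?S \<times> ?T)"
  proof (rule card_inj_on_le[where f = "\<lambda>Y. (X - Y, Y - X)"])
    show "inj_on (\<lambda>Y. (X - Y, Y - X)) {Y \<in> wsets n w. card (X - Y) = k}"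
      by (rule inj_onI) blast
    show "(\<lambda>Y. (X - Y, Y - X)) ` {Y \<in> wsets n w. card (X - Y) = k} \<subseteq> ?S \<times> ?T"
      using card_Diff_wsets[OF X] by (auto simp: wsets_def)
    show "finite (?S \<times> ?T)"
      using fX by simp
  qed
  with c show ?thesis by simp
qed

text \<open>The term of radius 0 counts the centre, which is not its own neighbour; hence the degree
  bound \<open>V - 1\<close>.\<close>

lemma V_eq_Suc: "V n r w = Suc (\<Sum>k=1..r. (w choose k) * ((n - w) choose k))"
  by (simp add: V_def sum.atLeast_Suc_atMost[of 0 r])

lemma near_sphere:
  assumes "X \<in> wsets n w" "Y \<in> wsets n w" "near d X Y"
  shows "card (X - Y) \<in> {1..d - 1}"
proof -
  have "X - Y \<noteq> {}"
  proof
    assume "X - Y = {}"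
    then have "X \<subseteq> Y" by auto
    then have "X = Y"
      using assms finite_mem_wsets[OF assms(2)] by (intro card_subset_eq) (auto simp: wsets_def)
    then show False
      using assms by (simp add: near_def)
  qed
  then have "card (X - Y) \<noteq> 0"
    using finite_mem_wsets[OF assms(1)] by simp
  then show ?thesis
    using assms by (auto simp: near_def)
qed

lemma card_near_le:
  assumes X: "X \<in> wsets n w"
  shows "card {Y \<in> wsets n w. near d X Y} \<le> V n (d - 1) w - 1"
proof -
  have "card {Y \<in> wsets n w. near d X Y}
      \<le> card (\<Union>k\<in>{1..d - 1}. {Y \<in> wsets n w. card (X - Y) = k})"
    by (rule card_mono) (use near_sphere[OF X] in auto)
  also have "\<dots> \<le> (\<Sum>k=1..d - 1. card {Y \<in> wsets n w. card (X - Y) = k})"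
    by (rule card_UN_le) simp
  also have "\<dots> \<le> (\<Sum>k=1..d - 1. (w choose k) * ((n - w) choose k))"
    by (rule sum_mono) (rule card_sphere_le[OF X])
  finally show ?thesis
    by (simp add: V_eq_Suc)
qed

section \<open>Intersections of two spheres and triangles\<close>

text \<open>\<open>X\<close> and \<open>Y\<close> cut the ground set into four cells. The number
  \<open>l\<close> of points of \<open>Z\<close> outside \<open>X \<union> Y\<close> fixes how many
  points \<open>Z\<close> takes from \<open>Y - X\<close> and from \<open>X - Y\<close> and how many
  it misses in \<open>X \<inter> Y\<close>; the binomials in \<open>p\<close> count these
  choices.\<close>

lemma card_two_spheres_le:
  assumes X: "X \<in> wsets n w" and Y: "Y \<in> wsets n w" and k: "card (X - Y) = k"
  shows "card {Z \<in> wsets n w. card (X - Z) = i \<and> card (Y - Z) = j} \<le> p n w i j k"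
proof (cases "k > i + j")
  case True
  have "card (X - Y) \<le> i + j" if Z: "Z \<in> wsets n w" "card (X - Z) = i" "card (Y - Z) = j" for Z
  proof -
    have "card (X - Y) \<le> card ((X - Z) \<union> (Z - Y))"
      by (rule card_mono) (use finite_mem_wsets[OF X] finite_mem_wsets[OF Z(1)] in auto)
    also have "\<dots> \<le> card (X - Z) + card (Z - Y)"
      by (rule card_Un_le)
    finally show ?thesis
      using Z card_Diff_wsets[OF Y Z(1)] by simp
  qed
  then have "{Z \<in> wsets n w. card (X - Z) = i \<and> card (Y - Z) = j} = {}"
    using True k by force
  then show ?thesis by (simp only: card.empty)
next
  case False
  have fX: "finite X" "card X = w" "X \<subseteq> {..<n}" and fY: "finite Y" "card Y = w" "Y \<subseteq> {..<n}"
    using X Y finite_mem_wsets[OF X] finite_mem_wsets[OF Y] by (auto simp: wsets_def)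
  have k': "card (Y - X) = k"
    using card_Diff_wsets[OF X Y] k by simp
  have kI: "card (X \<inter> Y) + k = w"
    using card_Int_Diff[OF fX(1), of Y] k fX by simp
  then have kI': "card (X \<inter> Y) = w - k" by simp
  have "card (X \<union> Y) = w + k"
    using card_Un_disjoint[of X "Y - X"] fX fY k' by simp
  then have kO: "card ({..<n} - (X \<union> Y)) = n - w - k"
    using fX fY by (simp add: card_Diff_subset)
  let ?O = "{..<n} - (X \<union> Y)"
  let ?lo = "Max {0, i - k, j - k, i + j - w}" and ?hi = "Min {i, j, i + j - k, n - w - k}"
  let ?Q = "\<lambda>l. {Z. Z \<subseteq> {..<n} \<and> card (Z \<inter> ?O) = l \<and> card (Z \<inter> (Y - X)) = i - l \<and>
    card (Z \<inter> (X - Y)) = j - l \<and> card (X \<inter> Y - Z) = i + j - k - l}"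
  let ?t = "\<lambda>l. ((n - w - k) choose l) * (k choose (i - l)) * (k choose (j - l)) *
              ((w - k) choose (i + j - k - l))"
  have Q: "card (?Q l) \<le> ?t l" for l
  proof -
    let ?C = "\<lambda>S m. {B. B \<subseteq> S \<and> card B = m}"
    let ?P = "?C ?O l \<times> ?C (Y - X) (i - l) \<times> ?C (X - Y) (j - l) \<times> ?C (X \<inter> Y) (i + j - k - l)"
    have "card (?Q l) \<le> card ?P"
    \<comment> \<open>The last component records points missed, because \<open>i + j - k - l\<close>
      counts those; the other three record points taken.\<close>
    proof (rule card_inj_on_le[where f = "\<lambda>Z. (Z \<inter> ?O, Z \<inter> (Y - X), Z \<inter> (X - Y), X \<inter> Y - Z)"])
      show "inj_on (\<lambda>Z. (Z \<inter> ?O, Z \<inter> (Y - X), Z \<inter> (X - Y), X \<inter> Y - Z)) (?Q l)"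
      proof (rule inj_on_inverseI)
        fix Z assume "Z \<in> ?Q l"
        then have "Z \<subseteq> {..<n}" by simp
        then show "(\<lambda>(P1, P2, P3, P4). P1 \<union> P2 \<union> P3 \<union> (X \<inter> Y - P4))
          (Z \<inter> ?O, Z \<inter> (Y - X), Z \<inter> (X - Y), X \<inter> Y - Z) = Z"
          unfolding prod.case by blast
      qed
      show "finite ?P" using fX fY by simp
    qed auto
    also have "card ?P = ?t l"
      using fX fY kO k k' kI' n_subsets[of "X \<inter> Y" "i + j - k - l"]
      by (simp add: card_cartesian_product n_subsets mult.assoc)
    finally show ?thesis .
  qed
  have finQ: "finite (?Q l)" for l
    by (rule finite_subset[of _ "Pow {..<n}"]) auto
  have "{Z \<in> wsets n w. card (X - Z) = i \<and> card (Y - Z) = j} \<subseteq> (\<Union>l\<in>{?lo..?hi}. ?Q l)"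
  proof
    fix Z assume Z': "Z \<in> {Z \<in> wsets n w. card (X - Z) = i \<and> card (Y - Z) = j}"
    then have Z: "Z \<in> wsets n w" "card (Z - X) = i" "card (Z - Y) = j" "card (X - Z) = i"
      "finite Z" "Z \<subseteq> {..<n}"
      using card_Diff_wsets[OF X, of Z] card_Diff_wsets[OF Y, of Z] finite_mem_wsets[of Z n w]
      by (auto simp: wsets_def)
    let ?l = "card (Z \<inter> ?O)" and ?b = "card (Z \<inter> (Y - X))" and ?a = "card (Z \<inter> (X - Y))"
      and ?c = "card (X \<inter> Y - Z)"
    have "Z - X = (Z \<inter> ?O) \<union> (Z \<inter> (Y - X))" using Z by auto
    moreover have "(Z \<inter> ?O) \<inter> (Z \<inter> (Y - X)) = {}" by auto
    ultimately have 1: "i = ?l + ?b"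
      using card_Un_disjoint[of "Z \<inter> ?O" "Z \<inter> (Y - X)"] Z by simp
    have "Z - Y = (Z \<inter> ?O) \<union> (Z \<inter> (X - Y))" using Z by auto
    moreover have "(Z \<inter> ?O) \<inter> (Z \<inter> (X - Y)) = {}" by auto
    ultimately have 2: "j = ?l + ?a"
      using card_Un_disjoint[of "Z \<inter> ?O" "Z \<inter> (X - Y)"] Z by simp
    have "card (X - Y) = ?a + card (X - Y - Z)"
      using card_Int_Diff[of "X - Y" Z] fX by (simp add: Int_commute)
    then have 3: "k = ?a + card (X - Y - Z)" using k by simp
    have "X - Z = (X - Y - Z) \<union> (X \<inter> Y - Z)" by auto
    moreover have "(X - Y - Z) \<inter> (X \<inter> Y - Z) = {}" by auto
    ultimately have 4: "i = card (X - Y - Z) + ?c"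
      using card_Un_disjoint[of "X - Y - Z" "X \<inter> Y - Z"] fX Z by simp
    have 5: "?l \<le> n - w - k"
      using kO by (metis Int_lower2 card_mono finite_Diff finite_lessThan)
    have 6: "?b \<le> k"
      using k' fY by (metis Int_lower2 card_mono finite_Diff)
    have 7: "?c + k \<le> w"
      using card_mono[OF _ Diff_subset, of "X \<inter> Y" Z] fX kI by simp
    define l where "l = ?l"
    \<comment> \<open>The sizes \<open>k\<close>, \<open>k\<close> and \<open>w - k\<close> of the
      inner cells give the lower bounds; nonnegative counts and the size of the outer cell give the
      upper ones.\<close>
    have "i - k \<le> l" "j - k \<le> l" "i + j - w \<le> l" "l \<le> i" "l \<le> j" "l \<le> i + j - k"
      "l \<le> n - w - k"
      unfolding l_def using 1 2 3 4 5 6 7 by linarith+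
    then have "l \<in> {?lo..?hi}" by simp
    moreover have "?b = i - l" "?a = j - l" "?c = i + j - k - l"
      unfolding l_def using 1 2 3 4 by linarith+
    then have "Z \<in> ?Q l"
      using Z(6) l_def by blast
    ultimately show "Z \<in> (\<Union>l\<in>{?lo..?hi}. ?Q l)" by blast
  qed
  then have "card {Z \<in> wsets n w. card (X - Z) = i \<and> card (Y - Z) = j}
      \<le> card (\<Union>l\<in>{?lo..?hi}. ?Q l)"
    by (rule card_mono[OF finite_UN_I[OF finite_atLeastAtMost finQ]])
  also have "\<dots> \<le> (\<Sum>l\<in>{?lo..?hi}. card (?Q l))"
    using card_UN_le[of "{?lo..?hi}" ?Q, OF finite_atLeastAtMost] .
  also have "\<dots> \<le> (\<Sum>l\<in>{?lo..?hi}. ?t l)"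
    using sum_mono[of "{?lo..?hi}" "\<lambda>l. card (?Q l)" ?t, OF Q] .
  also have "\<dots> = p n w i j k"
    using False by (simp only: p_def if_False)
  finally show ?thesis .
qed

text \<open>Pairs are sorted by \<open>k = card (X - Y)\<close>, \<open>i = card (X - Z)\<close> and
  \<open>j = card (Y - Z)\<close>: a sphere bounds the choices of \<open>Y\<close>, an intersection
  of two spheres those of \<open>Z\<close>. The factor 6 undoes the \<open>1 / 6\<close> in
  \<open>e\<close>.\<close>

lemma card_triangles_le:
  assumes X: "X \<in> wsets n w"
  shows "card {(Y, Z). Y \<in> {Y \<in> wsets n w. near d X Y} \<and> Z \<in> {Y \<in> wsets n w. near d X Y} \<and> near d Y Z}
    \<le> 6 * e n (d - 1) w"
proof -
  let ?r = "{1..d - 1}"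
  let ?Z = "\<lambda>i j Y. {Z \<in> wsets n w. card (X - Z) = i \<and> card (Y - Z) = j}"
  let ?T = "\<lambda>i j k. SIGMA Y:{Y \<in> wsets n w. card (X - Y) = k}. ?Z i j Y"
  have "card {(Y, Z). Y \<in> {Y \<in> wsets n w. near d X Y} \<and> Z \<in> {Y \<in> wsets n w. near d X Y} \<and> near d Y Z}
      \<le> card (\<Union>i\<in>?r. \<Union>j\<in>?r. \<Union>k\<in>?r. ?T i j k)"
  proof (rule card_mono)
    show "{(Y, Z). Y \<in> {Y \<in> wsets n w. near d X Y} \<and> Z \<in> {Y \<in> wsets n w. near d X Y} \<and> near d Y Z}
        \<subseteq> (\<Union>i\<in>?r. \<Union>j\<in>?r. \<Union>k\<in>?r. ?T i j k)"
    proof clarify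
      fix Y Z assume "Y \<in> wsets n w" "near d X Y" "Z \<in> wsets n w" "near d X Z" "near d Y Z"
      then show "(Y, Z) \<in> (\<Union>i\<in>?r. \<Union>j\<in>?r. \<Union>k\<in>?r. ?T i j k)"
        using near_sphere[OF X, of Y d] near_sphere[OF X, of Z d] near_sphere[of Y n w Z d] by blast
    qed
  qed auto
  also have "\<dots> \<le> (\<Sum>i\<in>?r. \<Sum>j\<in>?r. \<Sum>k\<in>?r. card (?T i j k))"
    by (intro order_trans[OF card_UN_le] sum_mono) auto
  also have "\<dots> \<le> (\<Sum>i\<in>?r. \<Sum>j\<in>?r. \<Sum>k\<in>?r. (w choose k) * ((n - w) choose k) * p n w i j k)"
  proof (intro sum_mono)
    fix i j k
    have "card (?T i j k) = (\<Sum>Y\<in>{Y \<in> wsets n w. card (X - Y) = k}. card (?Z i j Y))"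
      by simp
    also have "\<dots> \<le> (\<Sum>Y\<in>{Y \<in> wsets n w. card (X - Y) = k}. p n w i j k)"
      by (rule sum_mono) (use card_two_spheres_le[OF X] in auto)
    also have "\<dots> \<le> (w choose k) * ((n - w) choose k) * p n w i j k"
      using card_sphere_le[OF X, of k] by simp
    finally show "card (?T i j k) \<le> (w choose k) * ((n - w) choose k) * p n w i j k" .
  qed
  finally show ?thesis
    unfolding e_def by (simp flip: of_nat_sum of_nat_mult)
qed

text \<open>The term \<open>i = j = k = 1\<close> suffices: \<open>p n w 1 1 1\<close> is
  \<open>n - 2\<close>, so the term is at least 8 and exceeds 6. The bound keeps the fugacity
  \<open>1 / (5 * sqrt e)\<close> at most \<open>1/5\<close>.\<close>

lemma e_ge_1:
  assumes "1 \<le> r" "2 \<le> w" "2 * w \<le> n"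
  shows "1 \<le> e n r w"
proof -
  let ?f = "\<lambda>i j k. (w choose k) * ((n - w) choose k) * p n w i j k"
  have "Min {1, 1, 1 + 1 - 1, n - w - 1} = (1::nat)"
    using assms by auto
  moreover have "Max {0, 1 - 1, 1 - 1, 1 + 1 - w} = (0::nat)"
    using assms by auto
  ultimately have "p n w 1 1 1 = (w - 1) + (n - w - 1)"
    unfolding p_def by (simp add: sum.atLeast_Suc_atMost)
  then have p2: "2 \<le> p n w 1 1 1"
    using assms by linarith
  have "2 * 2 * 2 \<le> w * (n - w) * p n w 1 1 1"
    using assms p2 by (intro mult_le_mono) linarith+
  also have "w * (n - w) * p n w 1 1 1 = ?f 1 1 1" by simp
  also have "?f 1 1 1 \<le> (\<Sum>k=1..r. ?f 1 1 k)"
    by (rule member_le_sum[where f = "?f 1 1"]) (use assms in auto)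
  also have "\<dots> \<le> (\<Sum>j=1..r. \<Sum>k=1..r. ?f 1 j k)"
    by (rule member_le_sum[where f = "\<lambda>j. \<Sum>k=1..r. ?f 1 j k"]) (use assms in auto)
  also have "\<dots> \<le> (\<Sum>i=1..r. \<Sum>j=1..r. \<Sum>k=1..r. ?f i j k)"
    by (rule member_le_sum[where f = "\<lambda>i. \<Sum>j=1..r. \<Sum>k=1..r. ?f i j k"]) (use assms in auto)
  finally have "real 8 \<le> real (\<Sum>i=1..r. \<Sum>j=1..r. \<Sum>k=1..r. ?f i j k)"
    by (simp only: of_nat_le_iff)
  then show ?thesis
    unfolding e_def by linarith
qed

section \<open>From independent sets to codes\<close>

text \<open>Supports are turned injectively into characteristic lists. Distinct non-adjacent sets
  have \<open>card (X - Y) \<ge> d\<close>, and the two differences add up to at least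
  \<open>2 * d\<close>.\<close>

lemma card_code_le_A:
  assumes C: "C \<in> indep_sets (near d) (wsets n w)"
  shows "card C \<le> A n (2 * d) w"
proof -
  let ?enc = "\<lambda>X. map (\<lambda>i. i \<in> X) [0..<n]"
  have C': "X \<subseteq> {..<n}" "card X = w" "finite X" if "X \<in> C" for X
    using that C finite_mem_wsets[of X n w] by (auto simp: indep_sets_def wsets_def)
  have "inj_on ?enc C"
  proof (rule inj_onI)
    fix X Y assume "X \<in> C" "Y \<in> C" "?enc X = ?enc Y"
    then have "\<forall>i<n. i \<in> X \<longleftrightarrow> i \<in> Y" by (simp add: list_eq_iff_nth_eq)
    then show "X = Y" using C'(1)[OF \<open>X \<in> C\<close>] C'(1)[OF \<open>Y \<in> C\<close>] by auto
  qed
  then have "card C = card (?enc ` C)"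
    by (simp add: card_image)
  moreover have "?enc ` C \<in> constant_weight_codes n (2 * d) w"
  proof -
    have "hamming_weight (?enc X) = w" if "X \<in> C" for X
    proof -
      have "{i. i < length (?enc X) \<and> ?enc X ! i} = X"
        using C'(1)[OF that] by auto
      then show ?thesis using C'(2)[OF that] by (simp only: hamming_weight_def)
    qed
    moreover have "2 * d \<le> hamming_dist (?enc X) (?enc Y)"
      if XY: "X \<in> C" "Y \<in> C" "?enc X \<noteq> ?enc Y" for X Y
    proof -
      have "{i. i < length (?enc X) \<and> ?enc X ! i \<noteq> ?enc Y ! i} = (X - Y) \<union> (Y - X)"
        using C'(1)[OF XY(1)] C'(1)[OF XY(2)] by auto
      then have "hamming_dist (?enc X) (?enc Y) = card ((X - Y) \<union> (Y - X))"
        by (simp only: hamming_dist_def)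
      also have "\<dots> = card (X - Y) + card (Y - X)"
        using C'(3)[OF XY(1)] C'(3)[OF XY(2)] by (intro card_Un_disjoint) auto
      also have "card (Y - X) = card (X - Y)"
        using XY C by (intro card_Diff_wsets[of _ n w]) (auto simp: indep_sets_def)
      finally have h: "hamming_dist (?enc X) (?enc Y) = 2 * card (X - Y)" by simp
      have "\<not> near d X Y" "X \<noteq> Y"
        using XY C by (auto simp: indep_sets_def indep_def)
      then show ?thesis
        unfolding h using \<open>card (Y - X) = card (X - Y)\<close> by (auto simp: near_def)
    qed
    ultimately show ?thesis
      by (auto simp: constant_weight_codes_def)
  qed
  ultimately show ?thesis
    unfolding A_def using finite_constant_weight_codes by (intro Max_ge) auto
qed

subsection \<open>Choice of the fugacity\<close>

lemma half_le_ln2: "1/2 \<le> ln (2 :: real)"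
  using exp_half_le2 by (subst ln_ge_iff) simp_all

lemma log2_1024: "log 2 1024 = (10 :: real)"
  using log_pow_cancel[of 2 10] by simp

text \<open>Applying \<open>1 + x \<le> exp x\<close> around \<open>s = 10\<close>, where
  \<open>2 powr (s / 2)\<close> is 32, gives a linear lower bound with room to spare. The start
  \<open>s = 10\<close> matches the threshold \<open>1024 = 2 ^ 10\<close>.\<close>

lemma linear_le_powr_half:
  fixes s :: real
  assumes "10 \<le> s"
  shows "3/2 * s \<le> 4/5 * 2 powr (s / 2)"
proof -
  have "1 + (s - 10) / 4 \<le> 1 + (s - 10) / 2 * ln 2"
    using assms mult_left_mono[OF half_le_ln2, of "(s - 10) / 2"] by simp
  also have "\<dots> \<le> 2 powr ((s - 10) / 2)"
    unfolding powr_def using exp_ge_add_one_self[of "(s - 10) / 2 * ln 2"] by simp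
  finally have "32 * (1 + (s - 10) / 4) \<le> 2 powr 5 * 2 powr ((s - 10) / 2)"
    using mult_left_mono[of "1 + (s - 10) / 4" "2 powr ((s - 10) / 2)" 32] by simp
  also have "2 powr 5 * 2 powr ((s - 10) / 2) = 2 powr (s / 2)"
  proof -
    have "5 + (s - 10) / 2 = s / 2" by (simp add: field_simps)
    then show ?thesis by (simp only: powr_add[symmetric])
  qed
  finally have "32 * (1 + (s - 10) / 4) \<le> 2 powr (s / 2)" .
  moreover have "3/2 * s \<le> 4/5 * x" if "32 * (1 + (s - 10) / 4) \<le> x" for x
    using that assms by (simp add: field_simps)
  ultimately show ?thesis by blast
qed

text \<open>The hypothesis \<open>bal\<close> of the graph bound, freed of common factors, with
  \<open>6/25\<close> as the value of \<open>t\<^sup>2 * q\<close>. The exponent is at most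
  \<open>L / 4 + 3/10\<close>, so the exponential is at most \<open>3/2 * sqrt M\<close>, and
  another \<open>sqrt M\<close> is left to absorb \<open>L\<close>.\<close>

lemma fugacity_balance:
  fixes M L K :: real
  assumes M: "1024 \<le> M" and L: "L = log 2 M" and K: "K \<le> L / 5"
    and t: "t \<le> 1/5"
  shows "L * exp ((K + 6/25) / (1 - t)) \<le> 4/5 * M"
proof -
  have "log 2 1024 \<le> L"
    using M unfolding L by simp
  then have L10: "10 \<le> L" by (simp only: log2_1024)
  have "(K + 6/25) / (1 - t) \<le> (L / 5 + 6/25) / (1 - t)"
    using K t by (intro divide_right_mono) auto
  also have "\<dots> \<le> (L / 5 + 6/25) / (4/5)"
    using t L10 by (intro divide_left_mono) auto
  also have "\<dots> = L / 2 * (1/2) + 3/10" by simp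
  also have "\<dots> \<le> L / 2 * ln 2 + 3/10"
    using mult_left_mono[OF half_le_ln2, of "L / 2"] L10 by simp
  finally have "exp ((K + 6/25) / (1 - t)) \<le> exp (L / 2 * ln 2 + 3/10)"
    by simp
  also have "\<dots> = 2 powr (L / 2) * exp (3/10)"
    by (simp add: powr_def exp_add)
  also have "\<dots> \<le> 2 powr (L / 2) * (3/2)"
  proof (rule mult_left_mono)
    show "exp (3/10) \<le> (3/2 :: real)"
      using exp_bound[of "3/10"] by (simp add: power2_eq_square)
  qed simp
  finally have "L * exp ((K + 6/25) / (1 - t)) \<le> L * (2 powr (L / 2) * (3/2))"
    using L10 by (intro mult_left_mono) auto
  also have "\<dots> = (3/2 * L) * 2 powr (L / 2)" by simp
  also have "\<dots> \<le> (4/5 * 2 powr (L / 2)) * 2 powr (L / 2)"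
    using linear_le_powr_half[OF L10] by (intro mult_right_mono) auto
  also have "\<dots> = 4/5 * 2 powr L"
    by (simp add: powr_add[symmetric])
  also have "2 powr L = M"
    using M L by simp
  finally show ?thesis .
qed

section \<open>The two lower bounds and their combination\<close>

lemma A_ge_greedy:
  "real (n choose w) \<le> real (V n (d - 1) w) * real (A n (2 * d) w)"
proof -
  interpret fin_graph "wsets n w" "near d"
    by unfold_locales (auto simp: near_def)
  have "card (nbh X) \<le> V n (d - 1) w - 1" if "X \<in> wsets n w" for X
    using card_near_le[OF that] by (simp add: nbh_def)
  then obtain W where W: "W \<in> indep_sets (near d) (wsets n w)"
    "card (wsets n w) \<le> (V n (d - 1) w - 1 + 1) * card W"
    by (rule indep_set_greedy)
  have "n choose w \<le> V n (d - 1) w * card W"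
    using W(2) by (simp add: card_wsets V_eq_Suc)
  also have "\<dots> \<le> V n (d - 1) w * A n (2 * d) w"
    by (rule mult_left_mono[OF card_code_le_A[OF W(1)]]) simp
  finally show ?thesis
    by (metis of_nat_le_iff of_nat_mult)
qed

lemma A_ge_locally_sparse:
  fixes n d w :: nat and m :: real
  assumes e1: "1 \<le> e n (d - 1) w" and M: "1024 \<le> m"
    and m_eq: "m = real (V n (d - 1) w) / sqrt (e n (d - 1) w)"
  shows "real (n choose w) * log 2 m \<le> 10 * real (V n (d - 1) w) * real (A n (2 * d) w)"
proof -
  interpret fin_graph "wsets n w" "near d"
    by unfold_locales (auto simp: near_def)
  define v where "v = real (V n (d - 1) w)"
  define D where "D = v - 1"
  define E where "E = e n (d - 1) w"
  define L where "L = log 2 m"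
  \<comment> \<open>The factor \<open>D / v\<close> will turn the \<open>D\<close> of
    \<open>2 * D * card W\<close> into \<open>v\<close>.\<close>
  define K where "K = D / v * (L / 5)"
  \<comment> \<open>This makes the triangle term \<open>t\<^sup>2 * (6 * E)\<close> the constant
    \<open>6/25\<close>, while \<open>m / (5 * v)\<close> equals \<open>t\<close>.\<close>
  define t where "t = 1 / (5 * sqrt E)"
  have E1: "1 \<le> E" using e1 by (simp add: E_def)
  then have sE: "1 \<le> sqrt E" by simp
  have m: "1024 \<le> m" "v = m * sqrt E"
    using M m_eq sE by (simp_all add: E_def v_def)
  have mv: "m \<le> v"
    using mult_left_mono[OF sE, of m] m by simp
  then have v: "1024 \<le> v" using m(1) by linarith
  then have D: "0 < D" "D \<le> v" by (auto simp: D_def)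
  have L0: "0 \<le> L" using m by (simp add: L_def)
  \<comment> \<open>The balance inequality with \<open>K = 0\<close> and \<open>t = 0\<close> yields
    \<open>L \<le> m\<close>, which leads to \<open>K \<le> D / 5\<close>.\<close>
  have "L \<le> L * exp ((0 + 6/25) / (1 - 0))"
    using mult_left_mono[of 1 "exp (6/25)" L] L0 by simp
  also have "\<dots> \<le> 4/5 * m"
    using L0 by (intro fugacity_balance[OF m(1) L_def]) auto
  finally have "L \<le> m" using m by simp
  then have Lv: "L \<le> v" using mv by simp
  have KL: "K \<le> L / 5"
    using D L0 v mult_right_mono[of "D / v" 1 "L / 5"] by (simp add: K_def)
  have K0: "0 \<le> K" using D L0 v by (simp add: K_def)
  have t: "0 < t" "t \<le> 1/5"
    using sE by (auto simp: t_def field_simps)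
  have tE: "t\<^sup>2 * (6 * E) = 6/25"
    using E1 by (simp add: t_def power_divide power_mult_distrib)
  have K1: "K * v = D * (L / 5)" using v by (simp add: K_def)
  have "K \<le> D / 5"
    using mult_right_mono[of "L / v" 1 "D / 5"] Lv v D by (simp add: K_def mult.commute)
  then have DK: "4/5 * D \<le> D - K" "K \<le> D" using D by auto
  have "K * exp ((K + t\<^sup>2 * (6 * E)) / (1 - t)) = D / (5 * v) * (L * exp ((K + 6/25) / (1 - t)))"
    unfolding tE by (simp add: K_def)
  also have "\<dots> \<le> D / (5 * v) * (4/5 * m)"
    by (rule mult_left_mono, rule fugacity_balance[OF m(1) L_def KL t(2)]) (use D v in simp)
  also have "\<dots> = 4/5 * D * t"
    using m sE by (simp add: t_def field_simps)
  also have "\<dots> \<le> (D - K) * t"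
    using DK t by (intro mult_right_mono) auto
  finally have bal: "K * exp ((K + t\<^sup>2 * (6 * E)) / (1 - t)) \<le> (D - K) * t" .
  have deg: "real (card (nbh X)) \<le> D" if "X \<in> wsets n w" for X
  proof -
    have "card (nbh X) \<le> V n (d - 1) w - 1"
      using card_near_le[OF that] by (simp add: nbh_def)
    then have "card (nbh X) + 1 \<le> V n (d - 1) w"
      using V_eq_Suc[of n "d - 1" w] by linarith
    then show ?thesis
      unfolding D_def v_def by linarith
  qed
  have tri: "real (card {(y, z). y \<in> nbh X \<and> z \<in> nbh X \<and> near d y z}) \<le> 6 * E"
    if "X \<in> wsets n w" for X
    using card_triangles_le[OF that, of d] by (simp only: nbh_def E_def)
  have t1: "t < 1" using t by simp
  obtain W where W: "W \<in> indep_sets (near d) (wsets n w)"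
    "K * card (wsets n w) \<le> 2 * D * card W"
    using indep_set_locally_sparse[OF t(1) t1 K0 DK(2) deg tri bal] by blast
  have "K * real (n choose w) * v \<le> 2 * D * card W * v"
    using W(2) v by (intro mult_right_mono) (auto simp: card_wsets)
  then have le: "5 * (K * real (n choose w) * v) \<le> 5 * (2 * D * card W * v)" by linarith
  have "D * (real (n choose w) * L) = 5 * real (n choose w) * (D * (L / 5))" by simp
  also have "\<dots> = 5 * real (n choose w) * (K * v)" by (simp only: K1)
  also have "\<dots> = 5 * (K * real (n choose w) * v)" by simp
  also note le
  also have "5 * (2 * D * card W * v) = D * (10 * v * card W)" by simp
  finally have "D * (real (n choose w) * L) \<le> D * (10 * v * card W)" .
  then have "real (n choose w) * L \<le> 10 * v * card W"
    using D by simp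
  also have "\<dots> \<le> 10 * v * A n (2 * d) w"
    using card_code_le_A[OF W(1)] v by simp
  finally show ?thesis
    by (simp add: L_def v_def)
qed

theorem theorem15:
  fixes n d w :: nat
  assumes "0 < n" and "0 < d" and "0 < w"
    and "d \<le> w" and "real w \<le> real n / 2"
  shows "real (A n (2 * d) w) \<ge>
           real (n choose w) / real (V n (d - 1) w) *
           ((log 2 (real (V n (d - 1) w)) - log 2 (sqrt (e n (d - 1) w))) / 10)"
proof (cases "d = 1")
  \<comment> \<open>For \<open>d = 1\<close> the sum in \<open>e\<close> is empty and
    \<open>V\<close> is 1; as \<open>log 2 0 = 0\<close> by convention, the right-hand side is
    0.\<close>
  case True
  then show ?thesis by (simp add: V_def e_def log_def)
next
  case False
  \<comment> \<open>Now \<open>d \<ge> 2\<close> forces \<open>w \<ge> 2\<close>, so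
    \<open>e\<close> is positive and the logarithms combine to \<open>log 2 M\<close>.\<close>
  then have e1: "1 \<le> e n (d - 1) w"
    using assms by (intro e_ge_1) auto
  define M where "M = real (V n (d - 1) w) / sqrt (e n (d - 1) w)"
  have V0: "0 < real (V n (d - 1) w)" by (simp only: V_eq_Suc of_nat_0_less_iff zero_less_Suc)
  have M0: "0 < M" using V0 e1 by (simp add: M_def)
  have logM: "log 2 (real (V n (d - 1) w)) - log 2 (sqrt (e n (d - 1) w)) = log 2 M"
    unfolding M_def using V0 e1 by (subst log_divide) auto
  have "real (n choose w) * log 2 M \<le> 10 * real (V n (d - 1) w) * real (A n (2 * d) w)"
  proof (cases "1024 \<le> M")
    case True
    then show ?thesis using A_ge_locally_sparse[OF e1 _ M_def] by simp
  next
    case False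
    have "log 2 M \<le> log 2 1024"
      using False M0 by (subst log_le_cancel_iff) auto
    then have "log 2 M \<le> 10" by (simp only: log2_1024)
    then have "real (n choose w) * log 2 M \<le> real (n choose w) * 10"
      by (intro mult_left_mono) auto
    then show ?thesis using A_ge_greedy[of n w d] by simp
  qed
  then show ?thesis
    unfolding logM using V0 by (simp add: field_simps)
qed

end
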